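(* Let $R$ be a commutative ring, $I$ an ideal of $R$, $n\ge 3$, and $a\in R$ non-nilpotent. Let $\alpha(X)\in\mathrm{EO}_{2n}(R_a[X],I_a[X])$ with $\alpha(0)=\mathrm{Id}$. Then there is $d\ge 0$ such that for every $b\in a^dR$ there exists $\alpha^*(X)\in\mathrm{EO}_{2n}(R[X],I[X])$ with $\alpha^*(0)=\mathrm{Id}$ whose image under the localisation map $\mathrm{EO}_{2n}(R[X])\to\mathrm{EO}_{2n}(R_a[X])$ is $\alpha(bX)$.
   Context: Let $\sigma$ be the permutation of $\{1,\dots,2n\}$ with $\sigma(2i)=2i-1$, $\sigma(2i-1)=2i$. For a commutative ring $A$, $z\in A$ and $1\le i\ne j\le 2n$ with $i\ne\sigma(j)$, $oe_{ij}(z)=1_{2n}+z e_{ij}-z e_{\sigma(j)\sigma(i)}$ (orthogonal with respect to $\widetilde\psi_n=\sum_{i=1}^n(e_{2i-1,2i}+e_{2i,2i-1})$), and $\mathrm{EO}_{2n}(A)$ is the group they generate. For an ideal $J$ of $A$, $\mathrm{EO}_{2n}(J)$ is generated by the $oe_{ij}(x)$, $x\in J$, and $\mathrm{EO}_{2n}(A,J)$ is the normal closure of $\mathrm{EO}_{2n}(J)$ in $\mathrm{EO}_{2n}(A)$. $R_a$ is the localisation at $\{a^i\}$, $I_a[X]=IR_a[X]$, $I[X]=IR[X]$. *)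

theory Defs
  imports "HOL-Computational_Algebra.Polynomial" "Jordan_Normal_Form.Matrix"
begin

definition is_ideal :: "'r::comm_ring_1 set \<Rightarrow> bool" where
  "is_ideal J \<longleftrightarrow> 0 \<in> J \<and> (\<forall>x\<in>J. \<forall>y\<in>J. x + y \<in> J) \<and> (\<forall>r. \<forall>x\<in>J. r * x \<in> J)"

definition ideal_gen :: "'r::comm_ring_1 set \<Rightarrow> 'r set" where
  "ideal_gen S = \<Inter>{J. is_ideal J \<and> S \<subseteq> J}"

definition is_localisation :: "'a::comm_ring_1 \<Rightarrow> ('a \<Rightarrow> 'b::comm_ring_1) \<Rightarrow> bool" where
  "is_localisation a \<phi> \<longleftrightarrow>
     (\<forall>x y. \<phi> (x + y) = \<phi> x + \<phi> y) \<and> (\<forall>x y. \<phi> (x * y) = \<phi> x * \<phi> y) \<and> \<phi> 1 = 1 \<and>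
     (\<exists>u. \<phi> a * u = 1) \<and>
     (\<forall>x. \<phi> x = 0 \<longleftrightarrow> (\<exists>m. a ^ m * x = 0)) \<and>
     (\<forall>y. \<exists>r k. y * \<phi> a ^ k = \<phi> r)"

(* 0-based version of sigma: swaps 2k and 2k+1 (1-based pairs 2i-1, 2i) *)
definition sig :: "nat \<Rightarrow> nat" where
  "sig j = (if even j then j + 1 else j - 1)"

definition oe_ok :: "nat \<Rightarrow> nat \<Rightarrow> nat \<Rightarrow> bool" where
  "oe_ok n i j \<longleftrightarrow> i < 2 * n \<and> j < 2 * n \<and> i \<noteq> j \<and> i \<noteq> sig j"

definition oe :: "nat \<Rightarrow> nat \<Rightarrow> nat \<Rightarrow> 'r::comm_ring_1 \<Rightarrow> 'r mat" where
  "oe n i j z = mat (2 * n) (2 * n) (\<lambda>(p, q).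
      (if p = q then 1 else 0) + (if p = i \<and> q = j then z else 0)
      - (if p = sig j \<and> q = sig i then z else 0))"

definition oe_gens :: "nat \<Rightarrow> 'r::comm_ring_1 set \<Rightarrow> 'r mat set" where
  "oe_gens n S = {oe n i j z | i j z. oe_ok n i j \<and> z \<in> S}"

inductive_set gen_group :: "nat \<Rightarrow> 'r::comm_ring_1 mat set \<Rightarrow> 'r mat set"
  for n :: nat and G :: "'r mat set" where
  one: "1\<^sub>m (2 * n) \<in> gen_group n G"
| mul: "g \<in> G \<Longrightarrow> x \<in> gen_group n G \<Longrightarrow> g * x \<in> gen_group n G"
| inv: "g \<in> G \<Longrightarrow> g' \<in> carrier_mat (2 * n) (2 * n) \<Longrightarrow> g * g' = 1\<^sub>m (2 * n) \<Longrightarrow>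
        g' * g = 1\<^sub>m (2 * n) \<Longrightarrow> x \<in> gen_group n G \<Longrightarrow> g' * x \<in> gen_group n G"

definition EO :: "nat \<Rightarrow> 'r::comm_ring_1 mat set" where
  "EO n = gen_group n (oe_gens n UNIV)"

definition EO_ideal :: "nat \<Rightarrow> 'r::comm_ring_1 set \<Rightarrow> 'r mat set" where
  "EO_ideal n J = gen_group n (oe_gens n J)"

definition EO_rel :: "nat \<Rightarrow> 'r::comm_ring_1 set \<Rightarrow> 'r mat set" where
  "EO_rel n J = gen_group n
     {g * h * g' | g h g'. g \<in> EO n \<and> h \<in> EO_ideal n J \<and> g' \<in> carrier_mat (2 * n) (2 * n) \<and>
        g * g' = 1\<^sub>m (2 * n) \<and> g' * g = 1\<^sub>m (2 * n)}"

end

(* The relative group EO(A, J) is read off the absolute elementary group of the double ring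
   {(x, y) in A x A. x = y mod J}: alpha lies in EO(A, J) iff (1, alpha) is a product of
   pairs (oe_ij(x), oe_ij(y)) with x = y mod J, and for any such product (p, q) the matrix
   p^-1 q lies in EO(A, J).  So it suffices to dilate products of pairs, as in the absolute case.

   Over R_a[X], telescoping p(bX) p(0)^-1 leaves generators with parameter f(bX) - f(0), which are
   divisible by a high power of a when b is, conjugated by constant generators oe_kl(c).
   Conjugation by oe_kl(c) turns parameters divisible by a high power of a into parameters that are
   still divisible by a given power: for non-opposite roots this is the commutator formula, and for
   opposite roots oe_ij is first split as a commutator through a third index, which exists since n >= 3.
   Hence (1, alpha(bX)) lifts to a product of pairs (beta, gamma) over R[X]; normalising both at X = 0,
   beta^-1 gamma is the required lift. *)

theory Submission
  imports Defs "Jordan_Normal_Form.Char_Poly"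
begin

section \<open>Commutator relations\<close>

lemma sig_sig [simp]: "sig (sig j) = j"
  by (auto simp: sig_def)

lemma sig_neq [simp]: "sig j \<noteq> j" "j \<noteq> sig j"
  by (auto simp: sig_def elim: oddE)

lemma sig_eq_iff [simp]: "sig i = sig j \<longleftrightarrow> i = j"
  by (metis sig_sig)

lemma sig_less_iff [simp]: "sig j < 2 * n \<longleftrightarrow> j < 2 * n"
  by (auto simp: sig_def elim!: evenE oddE)

lemma oe_carrier [simp]: "oe n i j z \<in> carrier_mat (2 * n) (2 * n)"
  by (simp add: oe_def)

lemma oe_dim [simp]: "dim_row (oe n i j z) = 2 * n" "dim_col (oe n i j z) = 2 * n"
  by (simp_all add: oe_def)

lemma oe_index [simp]:
  "p < 2 * n \<Longrightarrow> q < 2 * n \<Longrightarrow> oe n i j z $$ (p, q) =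
     (if p = q then 1 else 0) + (if p = i \<and> q = j then z else 0)
      - (if p = sig j \<and> q = sig i then z else 0)"
  by (simp add: oe_def)

text \<open>Left multiplication by a root element amounts to two row operations. Identities between
  products are therefore compared row by row, acting on an arbitrary matrix
  \<open>M\<close>.\<close>

lemma oe_mult_index:
  assumes "M \<in> carrier_mat (2 * n) (2 * n)" "p < 2 * n" "q < 2 * n" "i < 2 * n" "j < 2 * n"
  shows "(oe n i j z * M) $$ (p, q) = M $$ (p, q) + (if p = i then z * M $$ (j, q) else 0)
           - (if p = sig j then z * M $$ (sig i, q) else 0)"
proof -
  have "(oe n i j z * M) $$ (p, q) = (\<Sum>k\<in>{0..<2*n}. oe n i j z $$ (p, k) * M $$ (k, q))"
    using assms by (simp add: scalar_prod_def)
  also have "\<dots> = (\<Sum>k\<in>{0..<2*n}. (if k = p then M $$ (k, q) else 0)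
       + (if k = j then (if p = i then z * M $$ (k, q) else 0) else 0)
       - (if k = sig i then (if p = sig j then z * M $$ (k, q) else 0) else 0))"
    using assms by (intro sum.cong) (auto simp: algebra_simps)
  also have "\<dots> = M $$ (p, q) + (if p = i then z * M $$ (j, q) else 0)
           - (if p = sig j then z * M $$ (sig i, q) else 0)"
    using assms by (simp add: sum.distrib sum_subtractf)
  finally show ?thesis .
qed

lemma oe_0 [simp]: "oe n i j 0 = 1\<^sub>m (2 * n)"
  by (rule eq_matI) auto

text \<open>Each root element has two names, since its two off-diagonal terms exchange roles under
  the flip. This reduces index coincidences involving \<open>sig\<close> to plain ones.\<close>

lemma oe_flip:
  assumes "oe_ok n i j"
  shows "oe n i j z = oe n (sig j) (sig i) (- z)"
proof (rule eq_matI)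
  fix p q assume "p < dim_row (oe n (sig j) (sig i) (- z))" "q < dim_col (oe n (sig j) (sig i) (- z))"
  then have pq: "p < 2 * n" "q < 2 * n" by auto
  have "i \<noteq> sig j" "sig j \<noteq> i" using assms by (auto simp: oe_ok_def)
  then show "oe n i j z $$ (p, q) = oe n (sig j) (sig i) (- z) $$ (p, q)"
    using pq by (cases "p = i"; cases "p = sig j") simp_all
qed simp_all

lemma oe_ok_flip: "oe_ok n i j \<Longrightarrow> oe_ok n (sig j) (sig i)"
  unfolding oe_ok_def by (metis sig_sig sig_less_iff)

lemma oe_mult_carrier [simp]:
  "M \<in> carrier_mat (2 * n) (2 * n) \<Longrightarrow> oe n i j x * M \<in> carrier_mat (2 * n) (2 * n)"
  by (rule mult_carrier_mat) simp_all

lemma oe_add: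
  assumes "oe_ok n i j"
  shows "oe n i j x * oe n i j y = oe n i j (x + y)"
proof (rule eq_matI)
  fix p q assume "p < dim_row (oe n i j (x + y))" "q < dim_col (oe n i j (x + y))"
  then have pq: "p < 2 * n" "q < 2 * n" by auto
  have "i \<noteq> sig j" "sig j \<noteq> i" "i \<noteq> j" "j \<noteq> i" "j \<noteq> sig i" "sig i \<noteq> j" "i < 2 * n" "j < 2 * n"
    using assms by (auto simp: oe_ok_def)
  then show "(oe n i j x * oe n i j y) $$ (p, q) = oe n i j (x + y) $$ (p, q)"
    using pq
    by (cases "p = i"; cases "p = sig j") (simp_all add: oe_mult_index del: index_mult_mat(1))
qed simp_all

lemma oe_minus:
  assumes "oe_ok n i j"
  shows "oe n i j x * oe n i j (- x) = 1\<^sub>m (2 * n)" "oe n i j (- x) * oe n i j x = 1\<^sub>m (2 * n)"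
  using assms by (simp_all add: oe_add)

text \<open>The inequalities say that neither row operation reads a row that the other one
  changes.\<close>

lemma oe_commute:
  assumes "oe_ok n i j" "oe_ok n k l" "j \<noteq> k" "i \<noteq> l" "j \<noteq> sig l" "k \<noteq> sig i"
    and M: "M \<in> carrier_mat (2 * n) (2 * n)"
  shows "oe n i j x * (oe n k l y * M) = oe n k l y * (oe n i j x * M)"
proof -
  have neq: "sig i \<noteq> k" "sig l \<noteq> j" "sig k \<noteq> i" "sig j \<noteq> l" "i \<noteq> sig k" "l \<noteq> sig j"
      "k \<noteq> j" "l \<noteq> i"
    using assms(3-6) by auto
  show ?thesis
  proof (rule eq_matI)
    fix p q assume "p < dim_row (oe n k l y * (oe n i j x * M))" "q < dim_col (oe n k l y * (oe n i j x * M))"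
    then have pq: "p < 2 * n" "q < 2 * n" using M by auto
    show "(oe n i j x * (oe n k l y * M)) $$ (p, q) = (oe n k l y * (oe n i j x * M)) $$ (p, q)"
      using assms neq pq unfolding oe_ok_def
      by (simp add: oe_mult_index del: index_mult_mat(1))
  qed (use M in auto)
qed

text \<open>The indices do chain up here, but both orders of multiplication create the same extra
  entry \<open>x * y\<close> at position \<open>(i, sig i)\<close>, where no root element lives;
  hence the commutator is trivial.\<close>

lemma oe_commute_sig:
  assumes "oe_ok n i j" and M: "M \<in> carrier_mat (2 * n) (2 * n)"
  shows "oe n i j x * (oe n j (sig i) y * M) = oe n j (sig i) y * (oe n i j x * M)"
proof (rule eq_matI)
  fix p q
  assume "p < dim_row (oe n j (sig i) y * (oe n i j x * M))" "q < dim_col (oe n j (sig i) y * (oe n i j x * M))"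
  then have pq: "p < 2 * n" "q < 2 * n" using M by auto
  have "i \<noteq> j" "j \<noteq> i" "sig i \<noteq> j" "sig j \<noteq> i" "i \<noteq> sig j" "j \<noteq> sig i"
    using assms(1) by (auto simp: oe_ok_def)
  then show "(oe n i j x * (oe n j (sig i) y * M)) $$ (p, q) = (oe n j (sig i) y * (oe n i j x * M)) $$ (p, q)"
    using assms pq unfolding oe_ok_def
    by ((cases "p = i"; cases "p = j"; cases "p = sig i"; cases "p = sig j"),
        simp_all add: oe_mult_index del: index_mult_mat(1), simp_all add: algebra_simps)
qed (use M in auto)

text \<open>The Chevalley commutator formula, as an exchange of adjacent factors; the trailing
  \<open>M\<close> lets it act inside a right-nested product.\<close>

lemma oe_mult:
  assumes "oe_ok n i j" "oe_ok n j l" "l \<noteq> i" "l \<noteq> sig i"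
    and M: "M \<in> carrier_mat (2 * n) (2 * n)"
  shows "oe n i j x * (oe n j l y * M) = oe n i l (x * y) * (oe n j l y * (oe n i j x * M))"
proof (rule eq_matI)
  let ?R = "oe n i l (x * y) * (oe n j l y * (oe n i j x * M))"
  fix p q assume "p < dim_row ?R" "q < dim_col ?R"
  then have pq: "p < 2 * n" "q < 2 * n" using M by auto
  have neq: "i \<noteq> j" "j \<noteq> i" "i \<noteq> l" "l \<noteq> j" "j \<noteq> l"
      "sig i \<noteq> j" "sig j \<noteq> i" "i \<noteq> sig j" "j \<noteq> sig i"
      "sig l \<noteq> j" "sig j \<noteq> l" "l \<noteq> sig j" "j \<noteq> sig l"
      "i \<noteq> sig l" "sig i \<noteq> l" "sig l \<noteq> i"
    using assms by (auto simp: oe_ok_def)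
  have lt: "i < 2 * n" "j < 2 * n" "l < 2 * n" using assms by (auto simp: oe_ok_def)
  \<comment> \<open>Only the four named rows are changed by any of the factors.\<close>
  consider "p = i" | "p = j" | "p = sig j" | "p = sig l" | "p \<notin> {i, j, sig j, sig l}" by blast
  then show "(oe n i j x * (oe n j l y * M)) $$ (p, q) = ?R $$ (p, q)"
    using M neq lt pq
    by cases (simp_all add: oe_mult_index ring_distribs mult.assoc del: index_mult_mat(1))
qed (use M in auto)

section \<open>Conjugation of one root element by another\<close>

lemma one_mult_square [simp]:
  assumes "(A :: 'r::comm_ring_1 mat) \<in> carrier_mat (2 * n) (2 * n)"
  shows "1\<^sub>m (2 * n) * A = A" "A * 1\<^sub>m (2 * n) = A"
  by (fact left_mult_one_mat[OF assms], fact right_mult_one_mat[OF assms])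

lemma assoc_mult_square:
  assumes "(A :: 'r::comm_ring_1 mat) \<in> carrier_mat (2 * n) (2 * n)"
    and "B \<in> carrier_mat (2 * n) (2 * n)" and "C \<in> carrier_mat (2 * n) (2 * n)"
  shows "A * B * C = A * (B * C)"
  using assms by (rule assoc_mult_mat)

lemma oe_cancel:
  assumes "oe_ok n i j" "M \<in> carrier_mat (2 * n) (2 * n)"
  shows "oe n i j x * (oe n i j (- x) * M) = M" "oe n i j (- x) * (oe n i j x * M) = M"
  using assms by (simp_all add: assoc_mult_square[of _ n, symmetric] oe_minus)

text \<open>A shared index leads either to the commutator formula or, with \<epsilon> = 0, to
  commuting elements. The data \<open>k'\<close>, \<open>l'\<close>, \<epsilon> are chosen before
  \<open>c\<close> and \<open>x\<close>: the two components of a pair will have different parameters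
  but must keep common indices.\<close>

lemma oe_conj_adjacent:
  assumes ij: "oe_ok n i j" and kl: "oe_ok n k l" and non: "\<not> (k = j \<and> l = i)" and adj: "j = k \<or> i = l"
  shows "\<exists>k' l' \<epsilon>. oe_ok n k' l' \<and> \<epsilon> \<in> {0, 1, - 1} \<and>
    (\<forall>c x. oe n i j c * (oe n k l x * oe n i j (- c)) = oe n k' l' (\<epsilon> * (c * x)) * oe n k l x)"
proof (cases "j = k")
  case True
  note jk = this
  show ?thesis
  proof (cases "l = sig i")
    case True
    have "oe n i j c * (oe n k l x * oe n i j (- c)) = oe n k l (0 * (c * x)) * oe n k l x" for c x :: 'a
      using ij jk True oe_commute_sig[OF ij, of "oe n i j (- c)" c x] by (simp add: oe_minus)
    then show ?thesis using kl by blast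
  next
    case False
    with jk non have li: "l \<noteq> i" by auto
    have "oe n i j c * (oe n k l x * oe n i j (- c)) = oe n i l (1 * (c * x)) * oe n k l x" for c x :: 'a
      using oe_mult[OF ij _ li False, of "oe n i j (- c)" c x] kl jk ij by (simp add: oe_minus)
    moreover have "oe_ok n i l"
      using ij kl li False by (auto simp: oe_ok_def)
    ultimately show ?thesis by blast
  qed
next
  case False
  with adj have il: "i = l" by auto
  with non False have kj: "k \<noteq> j" by auto
  show ?thesis
  proof (cases "k = sig j")
    case True
    have "oe n i j c * (oe n k l x * oe n i j (- c)) = oe n k l (0 * (c * x)) * oe n k l x" for c x :: 'a
      using ij il True kl oe_commute_sig[OF kl, of "oe n i j (- c)" x c] by (simp add: oe_minus)
    then show ?thesis using kl by blast
  next
    case False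
    have ok: "oe_ok n k j"
      using ij kl kj False by (auto simp: oe_ok_def)
    have "oe n i j c * (oe n k l x * oe n i j (- c)) = oe n k j (- 1 * (c * x)) * oe n k l x" for c x :: 'a
    proof -
      have ki: "oe_ok n k i" and "j \<noteq> k" "j \<noteq> sig k"
        using kl il kj False by auto
      \<comment> \<open>The conjugating element is now the second factor of the commutator, so the
        formula has to be solved for the conjugate; this produces \<epsilon> = -1.\<close>
      then have "oe n k i x * (oe n i j c * oe n i j (- c)) = oe n k j (x * c) * (oe n i j c * (oe n k i x * oe n i j (- c)))"
        by (intro oe_mult[OF ki ij]) simp_all
      then have "oe n k l x = oe n k j (x * c) * (oe n i j c * (oe n k l x * oe n i j (- c)))"
        using ij by (simp add: oe_minus il)
      then have "oe n k j (- (x * c)) * oe n k l x = oe n i j c * (oe n k l x * oe n i j (- c))"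
        using oe_cancel(2)[OF ok, of "oe n i j c * (oe n k l x * oe n i j (- c))" "x * c"]
        by (metis oe_carrier oe_mult_carrier)
      then show ?thesis by (simp add: mult.commute)
    qed
    then show ?thesis using ok by blast
  qed
qed

text \<open>The two excluded positions are the two names of the root opposite to
  \<open>(i, j)\<close>. Otherwise an index is shared directly, or after a flip, or the elements
  commute.\<close>

lemma oe_conj_nonopposite:
  assumes ij: "oe_ok n i j" and kl: "oe_ok n k l"
    and non: "\<not> (k = j \<and> l = i)" "\<not> (k = sig i \<and> l = sig j)"
  shows "\<exists>k' l' \<epsilon>. oe_ok n k' l' \<and> \<epsilon> \<in> {0, 1, - 1} \<and>
    (\<forall>c x. oe n i j c * (oe n k l x * oe n i j (- c)) = oe n k' l' (\<epsilon> * (c * x)) * oe n k l x)"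
proof -
  consider "j = k \<or> i = l" | "j = sig l \<or> i = sig k" | "j \<noteq> k" "i \<noteq> l" "j \<noteq> sig l" "k \<noteq> sig i"
    by (metis sig_sig)
  then show ?thesis
  proof cases
    case 1
    then show ?thesis using oe_conj_adjacent[OF ij kl] non by blast
  next
    case 2
    have "\<not> (sig l = j \<and> sig k = i)" using non by auto
    \<comment> \<open>Under its other name \<open>(sig l, sig k)\<close> the element shares an index
      with \<open>(i, j)\<close>; the sign of its parameter goes into \<epsilon>.\<close>
    from oe_conj_adjacent[OF ij oe_ok_flip[OF kl] this] 2 obtain k' l' and \<epsilon> :: 'a
      where ok: "oe_ok n k' l'" and e: "\<epsilon> \<in> {0, 1, - 1}"
        and eq: "\<And>c x. oe n i j c * (oe n (sig l) (sig k) x * oe n i j (- c))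
               = oe n k' l' (\<epsilon> * (c * x)) * oe n (sig l) (sig k) x" by blast
    have "oe n i j c * (oe n k l x * oe n i j (- c)) = oe n k' l' ((- \<epsilon>) * (c * x)) * oe n k l x" for c x :: 'a
      using eq[of c "- x"] by (simp add: oe_flip[OF kl])
    moreover have "- \<epsilon> \<in> {0, 1, - 1}" using e by auto
    ultimately show ?thesis using ok by blast
  next
    case 3
    have "oe n i j c * (oe n k l x * oe n i j (- c)) = oe n k l (0 * (c * x)) * oe n k l x" for c x :: 'a
      using oe_commute[OF ij kl 3, of "oe n i j (- c)" c x] ij by (simp add: oe_minus)
    then show ?thesis using kl by blast
  qed
qed

text \<open>Since \<open>n \<ge> 3\<close>, at least six indices are available and at most four are
  forbidden. Any remaining \<open>t\<close> makes \<open>oe_mult\<close> applicable to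
  \<open>oe n i t\<close> and \<open>oe n t j\<close>.\<close>

lemma oe_commutator:
  assumes ij: "oe_ok n i j" and n: "n \<ge> 3"
  obtains t where "oe_ok n i t" "oe_ok n t j" "t \<notin> {i, j, sig i, sig j}"
    "\<And>x y. oe n i j (x * y) = oe n i t x * oe n t j y * (oe n i t (- x) * oe n t j (- y))"
proof -
  have "card {i, j, sig i, sig j} \<le> 4"
    by (simp add: card_insert_if)
  then have "\<not> {..<6} \<subseteq> {i, j, sig i, sig j}"
    using card_mono[of "{i, j, sig i, sig j}" "{..<6::nat}"] by auto
  then obtain t where t: "t < 6" "t \<notin> {i, j, sig i, sig j}" by blast
  have neq: "t \<noteq> i" "t \<noteq> j" "t \<noteq> sig i" "t \<noteq> sig j" "i \<noteq> sig t"
    using t(2) by auto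
  have it: "oe_ok n i t" and tj: "oe_ok n t j"
    using ij n t neq by (auto simp: oe_ok_def)
  have "oe n i j (x * y) = oe n i t x * oe n t j y * (oe n i t (- x) * oe n t j (- y))" for x y
  proof -
    have ji: "j \<noteq> i" "j \<noteq> sig i" using ij by (auto simp: oe_ok_def)
    have "oe n i t x * oe n t j y * (oe n i t (- x) * oe n t j (- y))
        = oe n i t x * (oe n t j y * (oe n i t (- x) * oe n t j (- y)))"
      by (simp add: assoc_mult_square[of _ n])
    also have "\<dots> = oe n i j (x * y) * (oe n t j y * (oe n i t x * (oe n i t (- x) * oe n t j (- y))))"
      by (rule oe_mult[OF it tj ji]) simp
    also have "\<dots> = oe n i j (x * y)"
      using it tj by (simp add: oe_cancel oe_minus)
    finally show ?thesis by simp
  qed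
  then show ?thesis using that it tj t(2) by blast
qed

section \<open>Pairs of elementary matrices\<close>

definition mutual_inv :: "nat \<Rightarrow> 'r::comm_ring_1 mat \<Rightarrow> 'r mat \<Rightarrow> bool" where
  "mutual_inv n p p' \<longleftrightarrow> p \<in> carrier_mat (2 * n) (2 * n) \<and> p' \<in> carrier_mat (2 * n) (2 * n) \<and>
     p * p' = 1\<^sub>m (2 * n) \<and> p' * p = 1\<^sub>m (2 * n)"

lemma mutual_inv_one [simp]: "mutual_inv n (1\<^sub>m (2 * n)) (1\<^sub>m (2 * n))"
  by (simp add: mutual_inv_def)

lemma mutual_inv_oe: "oe_ok n i j \<Longrightarrow> mutual_inv n (oe n i j x) (oe n i j (- x))"
  by (simp add: mutual_inv_def oe_minus)

lemma mutual_inv_unique: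
  assumes "mutual_inv n p p'" "mutual_inv n p p''"
  shows "p' = p''"
proof -
  have c: "p \<in> carrier_mat (2 * n) (2 * n)" "p' \<in> carrier_mat (2 * n) (2 * n)"
      "p'' \<in> carrier_mat (2 * n) (2 * n)"
    and eqs: "p * p'' = 1\<^sub>m (2 * n)" "p' * p = 1\<^sub>m (2 * n)"
    using assms by (auto simp: mutual_inv_def)
  have "p' = p' * (p * p'')" using c eqs by simp
  also have "\<dots> = p' * p * p''" using c by (simp add: assoc_mult_square[of _ n])
  also have "\<dots> = p''" unfolding eqs using c by simp
  finally show ?thesis .
qed

lemma mutual_inv_mult:
  assumes "mutual_inv n p p'" "mutual_inv n r r'"
  shows "mutual_inv n (p * r) (r' * p')"
proof -
  have c: "p \<in> carrier_mat (2 * n) (2 * n)" "p' \<in> carrier_mat (2 * n) (2 * n)"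
      "r \<in> carrier_mat (2 * n) (2 * n)" "r' \<in> carrier_mat (2 * n) (2 * n)"
    and eqs: "p * p' = 1\<^sub>m (2 * n)" "p' * p = 1\<^sub>m (2 * n)" "r * r' = 1\<^sub>m (2 * n)" "r' * r = 1\<^sub>m (2 * n)"
    using assms by (auto simp: mutual_inv_def)
  have "p * r * (r' * p') = p * (r * r' * p')" "r' * p' * (p * r) = r' * (p' * p * r)"
    using c by (simp_all add: assoc_mult_square[of _ n] mult_carrier_mat[of _ "2 * n" "2 * n"])
  then have "p * r * (r' * p') = 1\<^sub>m (2 * n)" "r' * p' * (p * r) = 1\<^sub>m (2 * n)"
    unfolding eqs using c by (simp_all add: eqs)
  moreover have "p * r \<in> carrier_mat (2 * n) (2 * n)" "r' * p' \<in> carrier_mat (2 * n) (2 * n)"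
    using c by (auto intro: mult_carrier_mat)
  ultimately show ?thesis by (simp add: mutual_inv_def)
qed

text \<open>For a subring \<open>T\<close> of A x A this is the elementary group over
  \<open>T\<close>, written as pairs of matrices over A. There is no rule for inverses: closure of
  \<open>T\<close> under negation supplies them.\<close>

inductive_set EO_pairs :: "nat \<Rightarrow> ('r::comm_ring_1 \<times> 'r) set \<Rightarrow> ('r mat \<times> 'r mat) set"
  for n :: nat and T :: "('r \<times> 'r) set" where
  one: "(1\<^sub>m (2 * n), 1\<^sub>m (2 * n)) \<in> EO_pairs n T"
| mul: "oe_ok n i j \<Longrightarrow> (x, y) \<in> T \<Longrightarrow> (p, q) \<in> EO_pairs n T \<Longrightarrow>
        (oe n i j x * p, oe n i j y * q) \<in> EO_pairs n T"

lemma EO_pairs_carrier: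
  assumes "(p, q) \<in> EO_pairs n T"
  shows "p \<in> carrier_mat (2 * n) (2 * n)" "q \<in> carrier_mat (2 * n) (2 * n)"
  using assms by (induction rule: EO_pairs.induct) auto

lemma EO_pairs_mono: "T \<subseteq> T' \<Longrightarrow> (p, q) \<in> EO_pairs n T \<Longrightarrow> (p, q) \<in> EO_pairs n T'"
  by (rotate_tac, induction rule: EO_pairs.induct) (auto intro: EO_pairs.intros)

lemma EO_pairs_gen: "oe_ok n i j \<Longrightarrow> (x, y) \<in> T \<Longrightarrow> (oe n i j x, oe n i j y) \<in> EO_pairs n T"
  using EO_pairs.mul[OF _ _ EO_pairs.one] by fastforce

lemma EO_pairs_mult:
  assumes "(p, q) \<in> EO_pairs n T" "(p', q') \<in> EO_pairs n T"
  shows "(p * p', q * q') \<in> EO_pairs n T"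
  using assms
proof (induction rule: EO_pairs.induct)
  case one
  then show ?case using EO_pairs_carrier[OF one] by simp
next
  case (mul i j x y p q)
  then have "(oe n i j x * (p * p'), oe n i j y * (q * q')) \<in> EO_pairs n T"
    by (intro EO_pairs.mul)
  then show ?case
    using EO_pairs_carrier[OF mul.hyps(3)] EO_pairs_carrier[OF mul.prems] by (simp add: assoc_mult_square[of _ n])
qed

text \<open>The inverse is the reversed product of the generators at negated parameters.\<close>

lemma EO_pairs_ex_inverse:
  assumes "\<And>x y. (x, y) \<in> T \<Longrightarrow> (- x, - y) \<in> T" "(p, q) \<in> EO_pairs n T"
  shows "\<exists>p' q'. (p', q') \<in> EO_pairs n T \<and> mutual_inv n p p' \<and> mutual_inv n q q'"
  using assms(2)
proof (induction rule: EO_pairs.induct)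
  case one
  then show ?case using EO_pairs.one mutual_inv_one by blast
next
  case (mul i j x y p q)
  then obtain p' q' where "(p', q') \<in> EO_pairs n T" "mutual_inv n p p'" "mutual_inv n q q'" by blast
  then have "(p' * oe n i j (- x), q' * oe n i j (- y)) \<in> EO_pairs n T"
    "mutual_inv n (oe n i j x * p) (p' * oe n i j (- x))"
    "mutual_inv n (oe n i j y * q) (q' * oe n i j (- y))"
    using mul.hyps assms(1) by (auto intro: EO_pairs_mult EO_pairs_gen mutual_inv_mult mutual_inv_oe)
  then show ?case by blast
qed

lemma EO_pairs_inverse:
  assumes "\<And>x y. (x, y) \<in> T \<Longrightarrow> (- x, - y) \<in> T" "(p, q) \<in> EO_pairs n T"
    "mutual_inv n p p'" "mutual_inv n q q'"
  shows "(p', q') \<in> EO_pairs n T"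
  using EO_pairs_ex_inverse[OF assms(1,2)] assms(3,4) mutual_inv_unique by metis

section \<open>Conjugation of pairs whose parameters are highly divisible\<close>

lemma conj_mult:
  assumes c: "mutual_inv n c c'" and p: "p \<in> carrier_mat (2 * n) (2 * n)"
    and r: "r \<in> carrier_mat (2 * n) (2 * n)"
  shows "c * (p * r * c') = (c * (p * c')) * (c * (r * c'))"
proof -
  have cc: "c \<in> carrier_mat (2 * n) (2 * n)" "c' \<in> carrier_mat (2 * n) (2 * n)" "c' * c = 1\<^sub>m (2 * n)"
    using c by (auto simp: mutual_inv_def)
  have "(c * (p * c')) * (c * (r * c')) = c * (p * (c' * c * (r * c')))"
    using cc(1,2) p r by (simp add: assoc_mult_square[of _ n] mult_carrier_mat[of _ "2 * n" "2 * n"])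
  also have "\<dots> = c * (p * r * c')"
    using cc p r by (simp add: assoc_mult_square[of _ n] mult_carrier_mat[of _ "2 * n" "2 * n"])
  finally show ?thesis by simp
qed

lemma EO_pairs_conj_mult:
  assumes "mutual_inv n c c'" "mutual_inv n d d'"
    and "p \<in> carrier_mat (2 * n) (2 * n)" "q \<in> carrier_mat (2 * n) (2 * n)"
        "r \<in> carrier_mat (2 * n) (2 * n)" "t \<in> carrier_mat (2 * n) (2 * n)"
    and "(c * (p * c'), d * (q * d')) \<in> EO_pairs n T" "(c * (r * c'), d * (t * d')) \<in> EO_pairs n T"
  shows "(c * (p * r * c'), d * (q * t * d')) \<in> EO_pairs n T"
  using EO_pairs_mult[OF assms(7,8)] assms by (simp add: conj_mult)

text \<open>Divisibility by \<open>s ^ m\<close> inside \<open>T\<close>: the cofactors must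
  themselves form a pair in \<open>T\<close>. When \<open>T\<close> consists of pairs without
  denominators, this measures how large a denominator can still be absorbed.\<close>

definition scaled :: "'r::comm_ring_1 \<Rightarrow> nat \<Rightarrow> ('r \<times> 'r) set \<Rightarrow> ('r \<times> 'r) set" where
  "scaled s m T = (\<lambda>(x, y). (s ^ m * x, s ^ m * y)) ` T"

lemma scaledI: "(u, v) \<in> T \<Longrightarrow> x = s ^ m * u \<Longrightarrow> y = s ^ m * v \<Longrightarrow> (x, y) \<in> scaled s m T"
  by (force simp: scaled_def)

lemma scaledE:
  assumes "(x, y) \<in> scaled s m T"
  obtains u v where "(u, v) \<in> T" "x = s ^ m * u" "y = s ^ m * v"
  using assms by (auto simp: scaled_def)

text \<open>Later \<open>T\<close> is the image in R_a[X] of the double ring of R[X], and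
  \<open>s\<close> is the constant polynomial with value \<phi> a.\<close>

locale pair_subring =
  fixes T :: "('r::comm_ring_1 \<times> 'r) set" and s :: 'r
  assumes T_zero: "(0, 0) \<in> T" and T_one: "(1, 1) \<in> T" and T_s: "(s, s) \<in> T"
    and T_neg: "(x, y) \<in> T \<Longrightarrow> (- x, - y) \<in> T"
    and T_mult: "(x, y) \<in> T \<Longrightarrow> (x', y') \<in> T \<Longrightarrow> (x * x', y * y') \<in> T"
begin

lemma T_power: "(s ^ m, s ^ m) \<in> T"
  by (induction m) (auto intro: T_one T_s T_mult)

lemma scaled_neg: "(x, y) \<in> scaled s m T \<Longrightarrow> (- x, - y) \<in> scaled s m T"
  by (elim scaledE, rule scaledI, rule T_neg) simp_all

lemma scaled_mult:
  assumes "(x, y) \<in> scaled s m T" "(x', y') \<in> T"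
  shows "(x * x', y * y') \<in> scaled s m T"
  using assms(1)
  by (elim scaledE, intro scaledI[OF T_mult[OF _ assms(2)]]) (simp_all add: mult.assoc)

lemma scaled_antimono:
  assumes "m \<le> m'"
  shows "scaled s m' T \<subseteq> scaled s m T"
proof (intro subrelI)
  fix x y assume "(x, y) \<in> scaled s m' T"
  moreover have "s ^ m' * w = s ^ m * (s ^ (m' - m) * w)" for w
    using assms by (simp add: mult.assoc[symmetric] power_add[symmetric])
  ultimately show "(x, y) \<in> scaled s m T"
    by (elim scaledE, intro scaledI[OF T_mult[OF T_power[of "m' - m"]]]) simp_all
qed

text \<open>The multipliers \<open>c\<close>, \<open>d\<close> may lie outside \<open>T\<close>;
  their common denominator \<open>s ^ e\<close> is paid for with \<open>e\<close> of the available
  powers of \<open>s\<close>.\<close>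

lemma scaled_cancel:
  assumes "(x, y) \<in> scaled s (m + e) T" "(s ^ e * c, s ^ e * d) \<in> T"
  shows "(c * x, d * y) \<in> scaled s m T"
proof -
  obtain u v where uv: "(u, v) \<in> T" "x = s ^ (m + e) * u" "y = s ^ (m + e) * v"
    using assms(1) by (rule scaledE)
  show ?thesis
    unfolding uv(2,3) power_add by (rule scaledI[OF T_mult[OF assms(2) uv(1)]]) (simp_all only: mult_ac)
qed

text \<open>The conjugate involves the conjugating parameter only through one product
  \<open>c * x\<close>, so the loss is \<open>e\<close> powers.\<close>

lemma oe_conj_nonopposite_scaled:
  assumes ij: "oe_ok n i j" and kl: "oe_ok n k l"
    and non: "\<not> (k = j \<and> l = i)" "\<not> (k = sig i \<and> l = sig j)"
    and cd: "(s ^ e * c, s ^ e * d) \<in> T" and xy: "(x, y) \<in> scaled s (m + e) T"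
  shows "(oe n i j c * (oe n k l x * oe n i j (- c)), oe n i j d * (oe n k l y * oe n i j (- d)))
           \<in> EO_pairs n (scaled s m T)"
proof -
  from oe_conj_nonopposite[OF ij kl non] obtain k' l' and \<epsilon> :: 'r
    where ok: "oe_ok n k' l'" and e: "\<epsilon> \<in> {0, 1, - 1}"
      and eq: "\<And>c x. oe n i j c * (oe n k l x * oe n i j (- c))
             = oe n k' l' (\<epsilon> * (c * x)) * oe n k l x" by blast
  have xy': "(x, y) \<in> scaled s m T" using xy scaled_antimono[of m "m + e"] by auto
  have "(c * x, d * y) \<in> scaled s m T" using scaled_cancel[OF xy cd] .
  moreover have "(\<epsilon>, \<epsilon>) \<in> T" using e T_zero T_one T_neg[OF T_one] by auto
  ultimately have "(\<epsilon> * (c * x), \<epsilon> * (d * y)) \<in> scaled s m T"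
    using scaled_mult[of "c * x" "d * y" m \<epsilon> \<epsilon>] by (simp add: mult.commute)
  then show ?thesis unfolding eq
    using ok kl xy' by (intro EO_pairs_mult EO_pairs_gen)
qed

text \<open>For opposite roots the element is first split as a commutator. The exponent is doubled
  so that each of the two commutator parameters carries the factor \<open>s ^ (m + e)\<close> that
  the non-opposite case requires.\<close>

lemma oe_conj_scaled:
  assumes n: "n \<ge> 3" and ij: "oe_ok n i j" and kl: "oe_ok n k l"
    and cd: "(s ^ e * c, s ^ e * d) \<in> T" and xy: "(x, y) \<in> scaled s (2 * (m + e)) T"
  shows "(oe n i j c * (oe n k l x * oe n i j (- c)), oe n i j d * (oe n k l y * oe n i j (- d)))
           \<in> EO_pairs n (scaled s m T)"
proof (cases "(k = j \<and> l = i) \<or> (k = sig i \<and> l = sig j)")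
  case False
  then show ?thesis
    using xy scaled_antimono[of "m + e" "2 * (m + e)"] 
    by (intro oe_conj_nonopposite_scaled[OF ij kl _ _ cd]) auto
next
  case True
  obtain t where kt: "oe_ok n k t" and tl: "oe_ok n t l" and t: "t \<notin> {k, l, sig k, sig l}"
    and comm: "\<And>x y :: 'r. oe n k l (x * y) = oe n k t x * oe n t l y * (oe n k t (- x) * oe n t l (- y))"
    using oe_commutator[OF kl n] by metis
  let ?N = "m + e"
  obtain u v where T: "(u, v) \<in> T" and uv: "x = s ^ (2 * ?N) * u" "y = s ^ (2 * ?N) * v"
    using xy by (rule scaledE)
  let ?f = "s ^ ?N"
  have xy_eq: "x = ?f * (?f * u)" "y = ?f * (?f * v)"
    unfolding uv mult_2 power_add[of s ?N ?N] by (simp_all add: mult.assoc)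
  have f: "(?f, ?f) \<in> scaled s ?N T" using T_one by (rule scaledI) simp_all
  have g: "(?f * u, ?f * v) \<in> scaled s ?N T" using T by (rule scaledI) simp_all
  \<comment> \<open>Since \<open>t\<close> avoids all of \<open>k\<close>, \<open>l\<close> and
    their partners, neither \<open>(k, t)\<close> nor \<open>(t, l)\<close> is opposite to
    \<open>(i, j)\<close>.\<close>
  have non: "\<not> (k = j \<and> t = i)" "\<not> (k = sig i \<and> t = sig j)" 
    "\<not> (t = j \<and> l = i)" "\<not> (t = sig i \<and> l = sig j)"
    using True t by auto
  note kt' = oe_conj_nonopposite_scaled[OF ij kt non(1,2) cd] 
   and tl' = oe_conj_nonopposite_scaled[OF ij tl non(3,4) cd] 
  show ?thesis unfolding xy_eq comm
    by (intro EO_pairs_conj_mult mutual_inv_oe ij kt' tl' f g scaled_neg oe_mult_carrier oe_carrier)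
qed

text \<open>Conjugation is multiplicative, so the loss of exponent does not depend on the number of
  factors.\<close>

lemma EO_pairs_conj_scaled:
  assumes n: "n \<ge> 3" and ij: "oe_ok n i j" and cd: "(s ^ e * c, s ^ e * d) \<in> T"
    and pq: "(p, q) \<in> EO_pairs n (scaled s (2 * (m + e)) T)"
  shows "(oe n i j c * (p * oe n i j (- c)), oe n i j d * (q * oe n i j (- d)))
           \<in> EO_pairs n (scaled s m T)"
  using pq
proof (induction rule: EO_pairs.induct)
  case one
  then show ?case using ij by (simp add: oe_minus EO_pairs.one)
next
  case (mul k l x y p q)
  then show ?case
    using oe_conj_scaled[OF n ij mul.hyps(1) cd mul.hyps(2)]
    by (intro EO_pairs_conj_mult mutual_inv_oe ij) (auto intro: EO_pairs_carrier)
qed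

end

section \<open>Ring homomorphisms applied entrywise to pairs\<close>

lemma map_mat_oe:
  assumes "comm_ring_hom h"
  shows "map_mat h (oe n i j x) = oe n i j (h x)"
proof -
  interpret h: comm_ring_hom h by fact
  show ?thesis
    by (rule eq_matI) (simp_all add: h.hom_add h.hom_minus if_distrib[of h] cong: if_cong split del: if_split)
qed

lemma map_mat_one_square:
  assumes "comm_ring_hom h"
  shows "map_mat h (1\<^sub>m m) = 1\<^sub>m m"
proof -
  interpret h: comm_ring_hom h by fact
  show ?thesis by (rule h.mat_hom_one)
qed

lemma map_mat_mult_square:
  assumes "comm_ring_hom h" "A \<in> carrier_mat (2 * n) (2 * n)" "B \<in> carrier_mat (2 * n) (2 * n)"
  shows "map_mat h (A * B) = map_mat h A * map_mat h B"
proof -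
  interpret h: comm_ring_hom h by fact
  show ?thesis using assms(2,3) by (rule h.mat_hom_mult)
qed

lemma mutual_inv_map:
  assumes "comm_ring_hom h" "mutual_inv n p p'"
  shows "mutual_inv n (map_mat h p) (map_mat h p')"
  using assms(2) map_mat_mult_square[OF assms(1), of p n p'] map_mat_mult_square[OF assms(1), of p' n p]
  by (simp add: mutual_inv_def map_mat_one_square[OF assms(1)])

lemma EO_pairs_map:
  assumes h: "comm_ring_hom h" and pq: "(p, q) \<in> EO_pairs n T"
  shows "(map_mat h p, map_mat h q) \<in> EO_pairs n (map_prod h h ` T)"
  using pq
proof (induction rule: EO_pairs.induct)
  case one
  show ?case unfolding map_mat_one_square[OF h] by (rule EO_pairs.one)
next
  case (mul i j x y p q)
  then have "(h x, h y) \<in> map_prod h h ` T" by force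
  then show ?case
    using mul EO_pairs_carrier[OF mul.hyps(3)]
    by (simp add: map_mat_mult_square[OF h oe_carrier] map_mat_oe[OF h] EO_pairs.mul)
qed

text \<open>It suffices to lift the parameters of the generators. The lift is not canonical: an
  identity component may lift to a non-identity matrix.\<close>

lemma EO_pairs_lift:
  assumes h: "comm_ring_hom h" and pq: "(p, q) \<in> EO_pairs n (map_prod h h ` T)"
  shows "\<exists>p' q'. (p', q') \<in> EO_pairs n T \<and> map_mat h p' = p \<and> map_mat h q' = q"
  using pq
proof (induction rule: EO_pairs.induct)
  case one
  show ?case using EO_pairs.one map_mat_one_square[OF h] by blast
next
  case (mul i j x y p q)
  then obtain p' q' where IH: "(p', q') \<in> EO_pairs n T" "map_mat h p' = p" "map_mat h q' = q" by blast
  from mul.hyps(2) obtain u v where uv: "(u, v) \<in> T" "x = h u" "y = h v" by auto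
  have "(oe n i j u * p', oe n i j v * q') \<in> EO_pairs n T"
    using mul.hyps(1) uv(1) IH(1) by (rule EO_pairs.mul)
  moreover have "map_mat h (oe n i j u * p') = oe n i j x * p" "map_mat h (oe n i j v * q') = oe n i j y * q"
    using IH uv EO_pairs_carrier[OF IH(1)] by (simp_all add: map_mat_mult_square[OF h oe_carrier] map_mat_oe[OF h])
  ultimately show ?case by blast
qed

lemma comm_ring_hom_pcompose: "comm_ring_hom (\<lambda>p :: 'r::comm_ring_1 poly. pcompose p q)"
  by unfold_locales (simp_all add: pcompose_add pcompose_mult pcompose_1)

section \<open>Relative elementary groups as pairs\<close>

lemma is_ideal_uminus: "is_ideal J \<Longrightarrow> x \<in> J \<Longrightarrow> - x \<in> J"
  using mult_minus1 unfolding is_ideal_def by metis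

lemma is_ideal_ideal_gen: "is_ideal (ideal_gen S)"
  unfolding is_ideal_def ideal_gen_def by blast

lemma ideal_gen_subset: "S \<subseteq> ideal_gen S"
  unfolding ideal_gen_def by blast

lemma ideal_gen_least: "is_ideal J \<Longrightarrow> S \<subseteq> J \<Longrightarrow> ideal_gen S \<subseteq> J"
  unfolding ideal_gen_def by blast

text \<open>The preimage of an ideal under a ring homomorphism is an ideal, so checking generators
  is enough.\<close>

lemma ideal_gen_hom:
  assumes h: "comm_ring_hom h" and S: "h ` S \<subseteq> ideal_gen S'" and x: "x \<in> ideal_gen S"
  shows "h x \<in> ideal_gen S'"
proof -
  interpret h: comm_ring_hom h by fact
  have "is_ideal {x. h x \<in> ideal_gen S'}"
    using is_ideal_ideal_gen[of S'] by (auto simp: is_ideal_def h.hom_add h.hom_mult)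
  from ideal_gen_least[OF this, of S] S x show ?thesis by auto
qed

text \<open>Substitution fixes the constant generators. The function \<open>f\<close> allows both
  I[X] and I_a[X].\<close>

lemma ideal_gen_pcompose:
  "x \<in> ideal_gen ((\<lambda>r. [:f r:]) ` I) \<Longrightarrow> pcompose x q \<in> ideal_gen ((\<lambda>r. [:f r:]) ` I)"
  using ideal_gen_subset[of "(\<lambda>r. [:f r:]) ` I"]
  by (intro ideal_gen_hom[OF comm_ring_hom_pcompose]) auto

text \<open>The coefficientwise description of I[X] makes it possible to drop a constant term
  without leaving the ideal.\<close>

lemma ideal_gen_consts:
  assumes I: "is_ideal I"
  shows "ideal_gen ((\<lambda>r. [:r:]) ` I) = {p. \<forall>i. coeff p i \<in> I}"
proof
  have sum: "sum f A \<in> I" if "\<And>x. x \<in> A \<Longrightarrow> f x \<in> I" for f :: "nat \<Rightarrow> 'a" and A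
    using that I by (induction A rule: infinite_finite_induct) (auto simp: is_ideal_def)
  have "is_ideal {p. \<forall>i. coeff p i \<in> I}"
    using I by (auto simp: is_ideal_def coeff_mult intro!: sum)
  then show "ideal_gen ((\<lambda>r. [:r:]) ` I) \<subseteq> {p. \<forall>i. coeff p i \<in> I}"
    by (rule ideal_gen_least) (use I in \<open>auto simp: is_ideal_def coeff_pCons split: nat.split\<close>)
next
  note J = is_ideal_ideal_gen[of "(\<lambda>r. [:r:]) ` I"]
  have "p \<in> ideal_gen ((\<lambda>r. [:r:]) ` I)" if "\<forall>i. coeff p i \<in> I" for p
    using that
  proof (induction p)
    case 0
    then show ?case using J by (simp add: is_ideal_def)
  next
    case (pCons c p)
    have "\<forall>i. coeff p i \<in> I" using pCons.prems by (metis coeff_pCons_Suc)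
    then have "[:0, 1:] * p \<in> ideal_gen ((\<lambda>r. [:r:]) ` I)"
      using pCons.IH J unfolding is_ideal_def by blast
    moreover have "c \<in> I" using pCons.prems by (metis coeff_pCons_0)
    then have "[:c:] \<in> ideal_gen ((\<lambda>r. [:r:]) ` I)" using ideal_gen_subset[of "(\<lambda>r. [:r:]) ` I"] by blast
    ultimately have "[:c:] + [:0, 1:] * p \<in> ideal_gen ((\<lambda>r. [:r:]) ` I)"
      using J unfolding is_ideal_def by blast
    then show ?case by simp
  qed
  then show "{p. \<forall>i. coeff p i \<in> I} \<subseteq> ideal_gen ((\<lambda>r. [:r:]) ` I)" by blast
qed

section \<open>The double ring along an ideal, and the relative elementary group\<close>

definition cong_pairs :: "'r::comm_ring_1 set \<Rightarrow> ('r \<times> 'r) set" where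
  "cong_pairs J = {(x, y). y - x \<in> J}"

lemma cong_pairs_diag: "is_ideal J \<Longrightarrow> (x, x) \<in> cong_pairs J"
  by (simp add: cong_pairs_def is_ideal_def)

lemma cong_pairs_neg: "is_ideal J \<Longrightarrow> (x, y) \<in> cong_pairs J \<Longrightarrow> (- x, - y) \<in> cong_pairs J"
  using is_ideal_uminus[of J "y - x"] by (simp add: cong_pairs_def)

lemma cong_pairs_mult:
  assumes J: "is_ideal J" and "(x, y) \<in> cong_pairs J" "(x', y') \<in> cong_pairs J"
  shows "(x * x', y * y') \<in> cong_pairs J"
proof -
  have "y * (y' - x') + x' * (y - x) \<in> J"
    using assms by (simp add: cong_pairs_def is_ideal_def)
  moreover have "y * (y' - x') + x' * (y - x) = y * y' - x * x'" by (simp add: algebra_simps)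
  ultimately show ?thesis by (simp add: cong_pairs_def)
qed

lemma gen_group_pairs:
  assumes neg: "\<And>x y. (x, y) \<in> T \<Longrightarrow> (- x, - y) \<in> T"
    and G: "\<And>g. g \<in> G \<Longrightarrow> (1\<^sub>m (2 * n), g) \<in> EO_pairs n T"
    and x: "x \<in> gen_group n G"
  shows "(1\<^sub>m (2 * n), x) \<in> EO_pairs n T"
  using x
proof (induction rule: gen_group.induct)
  case one
  show ?case by (rule EO_pairs.one)
next
  case (mul g x)
  then show ?case using EO_pairs_mult[OF G[OF mul.hyps(1)] mul.IH] by simp
next
  case (inv g g' x)
  have "g \<in> carrier_mat (2 * n) (2 * n)" using EO_pairs_carrier[OF G[OF inv.hyps(1)]] by blast
  then have "(1\<^sub>m (2 * n), g') \<in> EO_pairs n T"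
    using inv.hyps by (intro EO_pairs_inverse[OF neg G[OF inv.hyps(1)]]) (auto simp: mutual_inv_def)
  then show ?case using EO_pairs_mult[OF _ inv.IH] by fastforce
qed

lemma gen_group_pairs_diag:
  assumes neg: "\<And>x y. (x, y) \<in> T \<Longrightarrow> (- x, - y) \<in> T"
    and G: "\<And>g. g \<in> G \<Longrightarrow> (g, g) \<in> EO_pairs n T"
    and x: "x \<in> gen_group n G"
  shows "(x, x) \<in> EO_pairs n T"
  using x
proof (induction rule: gen_group.induct)
  case one
  show ?case by (rule EO_pairs.one)
next
  case (mul g x)
  then show ?case using EO_pairs_mult[OF G[OF mul.hyps(1)] mul.IH] by simp
next
  case (inv g g' x)
  have "g \<in> carrier_mat (2 * n) (2 * n)" using EO_pairs_carrier[OF G[OF inv.hyps(1)]] by blast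
  then have "(g', g') \<in> EO_pairs n T"
    using inv.hyps by (intro EO_pairs_inverse[OF neg G[OF inv.hyps(1)]]) (auto simp: mutual_inv_def)
  then show ?case using EO_pairs_mult[OF _ inv.IH] by blast
qed

text \<open>A conjugate \<open>g * h * g'\<close> is the second component of
  \<open>(g, g) (1, h) (g', g')\<close>, and \<open>(1, h)\<close> is built from generators with
  parameters \<open>(0, z)\<close>, \<open>z \<in> J\<close>, and their inverses.\<close>

lemma EO_rel_pairs:
  assumes J: "is_ideal J" and \<alpha>: "\<alpha> \<in> EO_rel n J"
  shows "(1\<^sub>m (2 * n), \<alpha>) \<in> EO_pairs n (cong_pairs J)"
  using cong_pairs_neg[OF J] _ \<alpha>[unfolded EO_rel_def]
proof (rule gen_group_pairs)
  fix z assume "z \<in> {g * h * g' | g h g'. g \<in> EO n \<and> h \<in> EO_ideal n J \<and> g' \<in> carrier_mat (2 * n) (2 * n) \<and>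
        g * g' = 1\<^sub>m (2 * n) \<and> g' * g = 1\<^sub>m (2 * n)}"
  then obtain g h g' where z: "z = g * h * g'" and g: "g \<in> EO n" and h: "h \<in> EO_ideal n J"
    and g': "g' \<in> carrier_mat (2 * n) (2 * n)" "g * g' = 1\<^sub>m (2 * n)" "g' * g = 1\<^sub>m (2 * n)" by blast
  have gg: "(g, g) \<in> EO_pairs n (cong_pairs J)"
    using cong_pairs_neg[OF J] _ g[unfolded EO_def]
    by (rule gen_group_pairs_diag) (auto simp: oe_gens_def intro!: EO_pairs_gen cong_pairs_diag[OF J])
  have "(oe n i j 0, oe n i j z) \<in> EO_pairs n (cong_pairs J)" if "oe_ok n i j" "z \<in> J" for i j z
    using that by (intro EO_pairs_gen) (auto simp: cong_pairs_def)
  then have hh: "(1\<^sub>m (2 * n), h) \<in> EO_pairs n (cong_pairs J)"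
    by (intro gen_group_pairs[OF cong_pairs_neg[OF J] _ h[unfolded EO_ideal_def]]) (auto simp: oe_gens_def)
  have c: "g \<in> carrier_mat (2 * n) (2 * n)" using EO_pairs_carrier[OF gg] by blast
  have gi: "(g', g') \<in> EO_pairs n (cong_pairs J)"
    using g' c by (intro EO_pairs_inverse[OF cong_pairs_neg[OF J] gg]) (auto simp: mutual_inv_def)
  have "(g * 1\<^sub>m (2 * n) * g', g * h * g') \<in> EO_pairs n (cong_pairs J)"
    using gg hh gi by (intro EO_pairs_mult)
  then show "(1\<^sub>m (2 * n), z) \<in> EO_pairs n (cong_pairs J)"
    using c g'(2) z by simp
qed

lemma EO_pairs_fst_EO: "(p, q) \<in> EO_pairs n T \<Longrightarrow> p \<in> EO n"
  unfolding EO_def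
  by (induction rule: EO_pairs.induct) (auto simp: oe_gens_def intro!: gen_group.intros)

text \<open>Adding a generator on the left changes \<open>p' * q\<close> into
  \<open>(p' * oe n i j (y - x) * p) * (p' * q)\<close>. The new factor is a conjugate of an element
  of \<open>EO_ideal n J\<close>; the induction carries \<open>p' \<in> EO n\<close> so that this
  conjugation is allowed.\<close>

lemma EO_pairs_EO_rel:
  assumes J: "is_ideal J" and pq: "(p, q) \<in> EO_pairs n (cong_pairs J)"
  shows "\<exists>p'. mutual_inv n p p' \<and> p' \<in> EO n \<and> p' * q \<in> EO_rel n J"
  using pq
proof (induction rule: EO_pairs.induct)
  case one
  have "1\<^sub>m (2 * n) \<in> EO n" "1\<^sub>m (2 * n) \<in> EO_rel n J"
    unfolding EO_def EO_rel_def by (rule gen_group.one)+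
  then show ?case by (intro exI[of _ "1\<^sub>m (2 * n)"]) simp
next
  case (mul i j x y p q)
  note ok = mul.hyps(1)
  obtain p' where inv: "mutual_inv n p p'" and EO: "p' \<in> EO n" and rel: "p' * q \<in> EO_rel n J"
    using mul.IH by blast
  have c: "p \<in> carrier_mat (2 * n) (2 * n)" "p' \<in> carrier_mat (2 * n) (2 * n)" "q \<in> carrier_mat (2 * n) (2 * n)"
    using inv EO_pairs_carrier[OF mul.hyps(3)] by (auto simp: mutual_inv_def)
  have inv': "mutual_inv n (oe n i j x * p) (p' * oe n i j (- x))"
    using mutual_inv_mult[OF mutual_inv_oe[OF ok] inv] .
  \<comment> \<open>The diagonal pair is inverted inside \<open>EO_pairs\<close>, which exhibits the
    inverse as a product of generators and so as an element of \<open>EO n\<close>.\<close>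
  have "(oe n i j x * p, oe n i j x * p) \<in> EO_pairs n (cong_pairs J)"
  proof -
    have "p \<in> EO n" using EO_pairs_fst_EO[OF mul.hyps(3)] .
    then have "(p, p) \<in> EO_pairs n (cong_pairs J)"
      unfolding EO_def by (rule gen_group_pairs_diag[OF cong_pairs_neg[OF J], rotated -1])
        (auto simp: oe_gens_def intro!: EO_pairs_gen cong_pairs_diag[OF J])
    then show ?thesis by (intro EO_pairs.mul ok cong_pairs_diag[OF J])
  qed
  from EO_pairs_inverse[OF cong_pairs_neg[OF J] this inv' inv']
  have EO': "p' * oe n i j (- x) \<in> EO n" by (rule EO_pairs_fst_EO)
  have h: "oe n i j (y - x) \<in> EO_ideal n J"
  proof -
    have "oe n i j (y - x) \<in> oe_gens n J"
      using ok mul.hyps(2) by (auto simp: oe_gens_def cong_pairs_def)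
    then have "oe n i j (y - x) * 1\<^sub>m (2 * n) \<in> EO_ideal n J"
      unfolding EO_ideal_def by (intro gen_group.intros)
    then show ?thesis by simp
  qed
  have "(p' * oe n i j (y - x) * p) * (p' * q) \<in> EO_rel n J"
    using rel unfolding EO_rel_def
  proof (rule gen_group.mul[rotated])
    show "p' * oe n i j (y - x) * p \<in> {g * h * g' | g h g'. g \<in> EO n \<and> h \<in> EO_ideal n J \<and>
        g' \<in> carrier_mat (2 * n) (2 * n) \<and> g * g' = 1\<^sub>m (2 * n) \<and> g' * g = 1\<^sub>m (2 * n)}"
      using h EO inv unfolding mutual_inv_def by blast
  qed
  moreover have "(p' * oe n i j (y - x) * p) * (p' * q) = p' * oe n i j (- x) * (oe n i j y * q)"
  proof -
    have "(p' * oe n i j (y - x) * p) * (p' * q) = p' * (oe n i j (y - x) * (p * p' * q))"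
      using c by (simp add: assoc_mult_square[of _ n] mult_carrier_mat[of _ "2 * n" "2 * n"])
    also have "\<dots> = p' * (oe n i j (- x) * oe n i j y * q)"
      using inv c ok by (simp add: mutual_inv_def oe_add)
    also have "\<dots> = p' * oe n i j (- x) * (oe n i j y * q)"
      using c by (simp add: assoc_mult_square[of _ n] mult_carrier_mat[of _ "2 * n" "2 * n"])
    finally show ?thesis .
  qed
  ultimately show ?case using inv' EO' by auto
qed

section \<open>Dilation over the localised polynomial ring\<close>

locale poly_localisation =
  fixes a :: "'a::comm_ring_1" and \<phi> :: "'a \<Rightarrow> 'b::comm_ring_1" and I :: "'a set"
  assumes loc: "is_localisation a \<phi>" and I: "is_ideal I"
begin

sublocale phi: comm_ring_hom \<phi>
proof
  have add: "\<phi> (x + y) = \<phi> x + \<phi> y" for x y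
    using loc by (simp add: is_localisation_def)
  then show "\<phi> (x + y) = \<phi> x + \<phi> y" for x y .
  show "\<phi> 0 = 0" using add[of 0 0] by simp
qed (use loc in \<open>simp_all add: is_localisation_def\<close>)

sublocale Phi: map_poly_comm_ring_hom \<phi> ..

text \<open>\<open>\<Phi>\<close> is the map R[X] -> R_a[X]; \<open>J\<close> and \<open>J'\<close>
  are I[X] and I_a[X]; \<open>T\<close> holds the congruent pairs that come from R[X].\<close>

abbreviation "\<Phi> \<equiv> map_poly \<phi>"
abbreviation "J \<equiv> ideal_gen ((\<lambda>r. [:r:]) ` I)"
abbreviation "J' \<equiv> ideal_gen ((\<lambda>r. [:\<phi> r:]) ` I)"
abbreviation "s \<equiv> [:\<phi> a:]"
abbreviation "T \<equiv> map_prod \<Phi> \<Phi> ` cong_pairs J"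

lemma Phi_a: "\<Phi> [:a:] = s"
  by (simp add: hom_distribs)

lemma Phi_hom: "comm_ring_hom \<Phi>" ..

section \<open>Clearing denominators\<close>

lemma unit_power: "\<exists>u. s ^ k * u = 1"
proof -
  obtain u where "\<phi> a * u = 1" using loc by (auto simp: is_localisation_def)
  then have "s * [:u:] = 1" by (simp add: one_pCons mult.commute)
  then have "(s * [:u:]) ^ k = 1" by simp
  then show ?thesis by (metis power_mult_distrib)
qed

lemma clear_denominator: "\<exists>k r. s ^ k * x = \<Phi> r"
proof (induction x)
  case 0
  show ?case by (intro exI[of _ 0]) simp
next
  case (pCons c f)
  obtain k g where k: "s ^ k * f = \<Phi> g" using pCons.IH by blast
  obtain l r where l: "c * \<phi> a ^ l = \<phi> r" using loc unfolding is_localisation_def by metis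
  have "s ^ (k + l) * pCons c f = s ^ k * [:\<phi> a ^ l * c:] + s ^ l * ([:0, 1:] * (s ^ k * f))"
  proof -
    have "pCons c f = [:c:] + [:0, 1:] * f" by simp
    moreover have "s ^ l * [:c:] = [:\<phi> a ^ l * c:]"
      by (simp add: poly_const_pow mult.commute)
    ultimately show ?thesis by (simp only: power_add ring_distribs mult_ac)
  qed
  also have "\<dots> = \<Phi> ([:a:] ^ k * [:r:] + [:a:] ^ l * ([:0, 1:] * g))"
    using l by (simp only: k Phi.hom_add Phi.hom_mult Phi.hom_power Phi_a) (simp add: mult.commute hom_distribs)
  finally show ?case by blast
qed

text \<open>The elements whose denominators can be cleared with a numerator in \<open>J\<close> form
  an ideal of R_a[X], and it contains the generators of \<open>J'\<close>.\<close>

lemma clear_denominator_ideal: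
  assumes "x \<in> J'"
  shows "\<exists>k i. i \<in> J \<and> s ^ k * x = \<Phi> i"
proof -
  let ?S = "{x. \<exists>k i. i \<in> J \<and> s ^ k * x = \<Phi> i}"
  note ideal = is_ideal_ideal_gen[of "(\<lambda>r. [:r:]) ` I", unfolded is_ideal_def]
  have "is_ideal ?S"
    unfolding is_ideal_def
  proof (intro conjI ballI allI)
    show "0 \<in> ?S" using ideal by (auto intro!: exI[of _ 0])
  next
    fix x y assume "x \<in> ?S" "y \<in> ?S"
    then obtain k i l j where ij: "i \<in> J" "j \<in> J" and eq: "s ^ k * x = \<Phi> i" "s ^ l * y = \<Phi> j" by blast
    have "s ^ (k + l) * (x + y) = s ^ l * (s ^ k * x) + s ^ k * (s ^ l * y)"
      by (simp only: power_add ring_distribs mult_ac)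
    also have "\<dots> = \<Phi> ([:a:] ^ l * i + [:a:] ^ k * j)"
      by (simp only: eq Phi.hom_add Phi.hom_mult Phi.hom_power Phi_a)
    finally show "x + y \<in> ?S" using ij ideal by blast
  next
    fix r x assume "x \<in> ?S"
    then obtain k i where i: "i \<in> J" and eq: "s ^ k * x = \<Phi> i" by blast
    obtain l t where t: "s ^ l * r = \<Phi> t" using clear_denominator by blast
    have "s ^ (l + k) * (r * x) = (s ^ l * r) * (s ^ k * x)"
      by (simp only: power_add mult_ac)
    also have "\<dots> = \<Phi> (t * i)" by (simp only: eq t Phi.hom_mult)
    finally show "r * x \<in> ?S" using i ideal by blast
  qed
  moreover have "(\<lambda>r. [:\<phi> r:]) ` I \<subseteq> ?S"
  proof
    fix z assume "z \<in> (\<lambda>r. [:\<phi> r:]) ` I"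
    then obtain r where r: "r \<in> I" "z = [:\<phi> r:]" by blast
    then have "s ^ 0 * z = \<Phi> [:r:]" by (simp add: hom_distribs)
    moreover have "[:r:] \<in> J" using r ideal_gen_subset[of "(\<lambda>r. [:r:]) ` I"] by blast
    ultimately show "z \<in> ?S" by blast
  qed
  ultimately show ?thesis using ideal_gen_least assms by blast
qed

text \<open>Clearing \<open>x\<close> and \<open>y\<close> separately would lose the congruence of
  the numerators. Instead \<open>x\<close> and the difference \<open>y - x\<close> are cleared, the
  latter within the ideal, and \<open>y\<close> is recovered as their sum.\<close>

lemma clear_denominators_pair:
  assumes "(x, y) \<in> cong_pairs J'"
  obtains k u v where "(u, v) \<in> cong_pairs J" "s ^ k * x = \<Phi> u" "s ^ k * y = \<Phi> v"
proof -
  obtain k r where k: "s ^ k * x = \<Phi> r" using clear_denominator by blast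
  obtain l i where i: "i \<in> J" and l: "s ^ l * (y - x) = \<Phi> i"
    using clear_denominator_ideal[of "y - x"] assms by (auto simp: cong_pairs_def)
  have "s ^ (k + l) * x = s ^ l * (s ^ k * x)" by (simp only: power_add mult_ac)
  also have "\<dots> = \<Phi> ([:a:] ^ l * r)"
    by (simp only: k Phi.hom_mult Phi.hom_power Phi_a)
  finally have x: "s ^ (k + l) * x = \<Phi> ([:a:] ^ l * r)" .
  have "s ^ (k + l) * y = s ^ l * (s ^ k * x) + s ^ k * (s ^ l * (y - x))"
    by (simp add: power_add algebra_simps)
  also have "\<dots> = \<Phi> ([:a:] ^ l * r + [:a:] ^ k * i)"
    by (simp only: k l Phi.hom_add Phi.hom_mult Phi.hom_power Phi_a)
  finally have y: "s ^ (k + l) * y = \<Phi> ([:a:] ^ l * r + [:a:] ^ k * i)" .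
  have "[:a:] ^ k * i \<in> J" using i is_ideal_ideal_gen unfolding is_ideal_def by blast
  then have "([:a:] ^ l * r, [:a:] ^ l * r + [:a:] ^ k * i) \<in> cong_pairs J"
    by (simp add: cong_pairs_def)
  then show ?thesis using that x y by blast
qed

sublocale pair_subring T s
proof
  note J = is_ideal_ideal_gen[of "(\<lambda>r. [:r:]) ` I"]
  have diag: "(\<Phi> x, \<Phi> x) \<in> T" for x using cong_pairs_diag[OF J] by force
  show "(0, 0) \<in> T" "(1, 1) \<in> T" "(s, s) \<in> T"
    using diag[of 0] diag[of 1] diag[of "[:a:]"] by (simp_all add: Phi_a)
  show "(- x, - y) \<in> T" if xy: "(x, y) \<in> T" for x y
  proof -
    obtain u v where uv: "(u, v) \<in> cong_pairs J" "x = \<Phi> u" "y = \<Phi> v" using xy by auto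
    then have "(- x, - y) = map_prod \<Phi> \<Phi> (- u, - v)" by (simp add: Phi.hom_uminus)
    then show ?thesis using cong_pairs_neg[OF J uv(1)] by blast
  qed
  show "(x * x', y * y') \<in> T" if xy: "(x, y) \<in> T" "(x', y') \<in> T" for x y x' y'
  proof -
    obtain u v u' v' where uv: "(u, v) \<in> cong_pairs J" "x = \<Phi> u" "y = \<Phi> v"
        "(u', v') \<in> cong_pairs J" "x' = \<Phi> u'" "y' = \<Phi> v'" using xy by auto
    then have "(x * x', y * y') = map_prod \<Phi> \<Phi> (u * u', v * v')" by (simp add: Phi.hom_mult)
    then show ?thesis using cong_pairs_mult[OF J uv(1,4)] by blast
  qed
qed

section \<open>Substituting bX into parameters and into products\<close>

lemma cong_pairs_pcompose:
  "(x, y) \<in> cong_pairs J \<Longrightarrow> (pcompose x q, pcompose y q) \<in> cong_pairs J"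
  using ideal_gen_pcompose[of "y - x" "\<lambda>r. r" I q] by (simp add: cong_pairs_def pcompose_diff)

lemma cong_pairs_pcompose':
  "(x, y) \<in> cong_pairs J' \<Longrightarrow> (pcompose x q, pcompose y q) \<in> cong_pairs J'"
  using ideal_gen_pcompose[of "y - x" \<phi> I q] by (simp add: cong_pairs_def pcompose_diff)

lemma cong_pairs_tail:
  "(pCons c u, pCons d v) \<in> cong_pairs J \<Longrightarrow> (u, v) \<in> cong_pairs J"
  unfolding cong_pairs_def ideal_gen_consts[OF I]
  by (auto simp: coeff_pCons split: nat.splits dest: spec[of _ "Suc _"])

text \<open>For f = c + X u one has f(bX) - f(0) = bX u(bX). The factor \<open>a ^ (m + k)\<close>
  in \<open>b\<close> cancels the denominator \<open>s ^ k\<close> of \<open>x\<close> and leaves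
  \<open>s ^ m\<close>.\<close>

lemma dilate_difference:
  assumes s: "s ^ k * x = \<Phi> (pCons c u)" and b: "b = a ^ (m + k) * r"
  shows "pcompose x [:0, \<phi> b:] - pcompose x 0 = s ^ m * \<Phi> ([:0, r:] * pcompose u [:0, b:])"
proof -
  \<comment> \<open>The identity is first proved after multiplication by \<open>s ^ k\<close>; this
    factor is a unit and \<open>e\<close> removes it.\<close>
  obtain e where e: "s ^ k * e = 1" using unit_power by blast
  have comp: "s ^ k * pcompose x (\<Phi> q) = \<Phi> (pcompose (pCons c u) q)" for q
  proof -
    have "pcompose (s ^ k * x) (\<Phi> q) = \<Phi> (pcompose (pCons c u) q)"
      by (simp only: s phi.map_poly_pcompose)
    then show ?thesis by (simp only: pcompose_mult poly_const_pow pcompose_const)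
  qed
  have [simp]: "\<Phi> [:0, b:] = [:0, \<phi> b:]" by (simp add: hom_distribs)
  have "s ^ k * (pcompose x [:0, \<phi> b:] - pcompose x 0)
      = \<Phi> (pcompose (pCons c u) [:0, b:] - pcompose (pCons c u) 0)"
    using comp[of "[:0, b:]"] comp[of 0]
    by (simp only: right_diff_distrib Phi.hom_minus Phi.hom_zero \<open>\<Phi> [:0, b:] = [:0, \<phi> b:]\<close>)
  also have "pcompose (pCons c u) [:0, b:] - pcompose (pCons c u) 0
      = [:a:] ^ (m + k) * ([:0, r:] * pcompose u [:0, b:])"
  proof -
    have "[:0, b:] = [:a:] ^ (m + k) * [:0, r:]"
      unfolding b by (simp add: poly_const_pow)
    then show ?thesis by (simp add: pcompose_pCons mult.assoc)
  qed
  also have "\<Phi> \<dots> = s ^ k * (s ^ m * \<Phi> ([:0, r:] * pcompose u [:0, b:]))"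
    by (simp only: Phi.hom_mult Phi.hom_power Phi_a power_add mult_ac)
  finally have "e * (s ^ k * (pcompose x [:0, \<phi> b:] - pcompose x 0))
      = e * (s ^ k * (s ^ m * \<Phi> ([:0, r:] * pcompose u [:0, b:])))" by simp
  then show ?thesis using e by (simp only: mult.assoc[symmetric] mult.commute[of e]) simp
qed

text \<open>One exponent \<open>k\<close> clears both parameters, and \<open>d = m + k\<close>
  works. The tails \<open>u'\<close>, \<open>v'\<close> remain congruent modulo \<open>J\<close>,
  hence so do the cofactors.\<close>

lemma dilate_difference_scaled:
  assumes "(x, y) \<in> cong_pairs J'"
  shows "\<exists>d. \<forall>r. (pcompose x [:0, \<phi> (a ^ d * r):] - pcompose x 0, pcompose y [:0, \<phi> (a ^ d * r):] - pcompose y 0)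
           \<in> scaled s m T"
proof -
  obtain k u v where uv: "(u, v) \<in> cong_pairs J" and eq: "s ^ k * x = \<Phi> u" "s ^ k * y = \<Phi> v"
    using clear_denominators_pair[OF assms] by blast
  obtain c u' d v' where c: "u = pCons c u'" "v = pCons d v'" by (metis pCons_cases)
  have tail: "(u', v') \<in> cong_pairs J" using uv c cong_pairs_tail by blast
  show ?thesis
  proof (intro exI allI)
    fix r
    let ?b = "a ^ (m + k) * r"
    have "([:0, r:] * pcompose u' [:0, ?b:], [:0, r:] * pcompose v' [:0, ?b:]) \<in> cong_pairs J"
      by (intro cong_pairs_mult cong_pairs_diag cong_pairs_pcompose tail is_ideal_ideal_gen)
    then have "(\<Phi> ([:0, r:] * pcompose u' [:0, ?b:]), \<Phi> ([:0, r:] * pcompose v' [:0, ?b:])) \<in> T"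
      by force
    then show "(pcompose x [:0, \<phi> ?b:] - pcompose x 0, pcompose y [:0, \<phi> ?b:] - pcompose y 0) \<in> scaled s m T"
      using dilate_difference[OF eq(1)[unfolded c] refl, of m r] dilate_difference[OF eq(2)[unfolded c] refl, of m r]
      by (rule scaledI)
  qed
qed

text \<open>Telescoping of p(bX) p(0)^-1. The inverses \<open>p'\<close>, \<open>q'\<close> of the
  values at 0 are fixed before \<open>m\<close>, so the induction hypothesis is available at a
  larger exponent. Uniformity in \<open>r\<close> lets two bounds on \<open>d\<close> be
  combined.\<close>

lemma EO_pairs_dilate:
  assumes n: "n \<ge> 3" and pq: "(p, q) \<in> EO_pairs n (cong_pairs J')"
  shows "\<exists>p' q'. mutual_inv n (map_mat (\<lambda>f. pcompose f 0) p) p' \<and>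
    mutual_inv n (map_mat (\<lambda>f. pcompose f 0) q) q' \<and>
    (\<forall>m. \<exists>d. \<forall>r. (map_mat (\<lambda>f. pcompose f [:0, \<phi> (a ^ d * r):]) p * p',
                   map_mat (\<lambda>f. pcompose f [:0, \<phi> (a ^ d * r):]) q * q') \<in> EO_pairs n (scaled s m T))"
  using pq
proof (induction rule: EO_pairs.induct)
  case one
  show ?case
    by (intro exI[of _ "1\<^sub>m (2 * n)"]) (simp add: map_mat_one_square[OF comm_ring_hom_pcompose] EO_pairs.one)
next
  case (mul i j x y p q)
  note ok = mul.hyps(1)
  note hom = comm_ring_hom_pcompose[where 'r = 'b]
  note c = EO_pairs_carrier[OF mul.hyps(3)]
  obtain p' q' where inv: "mutual_inv n (map_mat (\<lambda>f. pcompose f 0) p) p'"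
      "mutual_inv n (map_mat (\<lambda>f. pcompose f 0) q) q'"
    and IH: "\<And>m. \<exists>d. \<forall>r. (map_mat (\<lambda>f. pcompose f [:0, \<phi> (a ^ d * r):]) p * p',
                   map_mat (\<lambda>f. pcompose f [:0, \<phi> (a ^ d * r):]) q * q') \<in> EO_pairs n (scaled s m T)"
    using mul.IH by blast
  have c': "p' \<in> carrier_mat (2 * n) (2 * n)" "q' \<in> carrier_mat (2 * n) (2 * n)"
    using inv by (auto simp: mutual_inv_def)
  let ?x = "pcompose x 0" and ?y = "pcompose y 0"
  \<comment> \<open>\<open>e\<close> bounds the denominators of the constant parameters of the
    conjugating generators; it does not depend on \<open>m\<close>.\<close>
  obtain e u v where uv: "(u, v) \<in> cong_pairs J" "s ^ e * ?x = \<Phi> u" "s ^ e * ?y = \<Phi> v"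
    using clear_denominators_pair[OF cong_pairs_pcompose'[OF mul.hyps(2)]] .
  have e: "(s ^ e * ?x, s ^ e * ?y) \<in> T"
    unfolding uv(2,3) using uv(1) by (rule map_prod_imageI)
  \<comment> \<open>With z(h) = (z(h) - z(0)) + z(0), the new generator splits off a small
    parameter, and the old product is conjugated by the constant generator
    \<open>oe n i j (pcompose z 0)\<close>.\<close>
  have split: "map_mat (\<lambda>f. pcompose f h) (oe n i j z * w) * (w' * oe n i j (- pcompose z 0))
      = oe n i j (pcompose z h - pcompose z 0) *
        (oe n i j (pcompose z 0) * (map_mat (\<lambda>f. pcompose f h) w * w' * oe n i j (- pcompose z 0)))"
    if w: "w \<in> carrier_mat (2 * n) (2 * n)" "w' \<in> carrier_mat (2 * n) (2 * n)" for h z :: "'b poly" and w w'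
  proof -
    let ?W = "map_mat (\<lambda>f. pcompose f h) w * (w' * oe n i j (- pcompose z 0))"
    have wc: "map_mat (\<lambda>f. pcompose f h) w \<in> carrier_mat (2 * n) (2 * n)"
        "w' * oe n i j (- pcompose z 0) \<in> carrier_mat (2 * n) (2 * n)" "?W \<in> carrier_mat (2 * n) (2 * n)"
      using w by (auto intro!: mult_carrier_mat)
    have "map_mat (\<lambda>f. pcompose f h) (oe n i j z * w) * (w' * oe n i j (- pcompose z 0))
        = oe n i j (pcompose z h) * ?W"
      using w wc
      by (simp only: map_mat_mult_square[OF hom oe_carrier w(1)] map_mat_oe[OF hom]
          assoc_mult_square[OF oe_carrier wc(1,2)])
    also have "\<dots> = oe n i j (pcompose z h - pcompose z 0) * oe n i j (pcompose z 0) * ?W"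
      by (simp add: oe_add[OF ok])
    also have "\<dots> = oe n i j (pcompose z h - pcompose z 0) * (oe n i j (pcompose z 0) * ?W)"
      by (rule assoc_mult_square[OF oe_carrier oe_carrier wc(3)])
    finally show ?thesis by (simp only: assoc_mult_square[OF wc(1) w(2) oe_carrier])
  qed
  have "\<exists>d. \<forall>r. (map_mat (\<lambda>f. pcompose f [:0, \<phi> (a ^ d * r):]) (oe n i j x * p) * (p' * oe n i j (- ?x)),
                 map_mat (\<lambda>f. pcompose f [:0, \<phi> (a ^ d * r):]) (oe n i j y * q) * (q' * oe n i j (- ?y)))
               \<in> EO_pairs n (scaled s m T)" for m
  proof -
    \<comment> \<open>The exponent \<open>2 * (m + e)\<close> is what conjugation with denominator
      \<open>e\<close> consumes.\<close>
    obtain d1 where d1: "\<And>r. (map_mat (\<lambda>f. pcompose f [:0, \<phi> (a ^ d1 * r):]) p * p',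
        map_mat (\<lambda>f. pcompose f [:0, \<phi> (a ^ d1 * r):]) q * q') \<in> EO_pairs n (scaled s (2 * (m + e)) T)"
      using IH[of "2 * (m + e)"] by blast
    obtain d2 where d2: "\<And>r. (pcompose x [:0, \<phi> (a ^ d2 * r):] - ?x, pcompose y [:0, \<phi> (a ^ d2 * r):] - ?y) \<in> scaled s m T"
      using dilate_difference_scaled[OF mul.hyps(2)] by blast
    show ?thesis
    proof (intro exI allI)
      fix r
      \<comment> \<open>This is a multiple of both \<open>a ^ d1\<close> and
        \<open>a ^ d2\<close>.\<close>
      let ?b = "a ^ (d1 + d2) * r"
      have b: "?b = a ^ d1 * (a ^ d2 * r)" "?b = a ^ d2 * (a ^ d1 * r)"
        by (simp_all only: power_add mult_ac)
      have "(map_mat (\<lambda>f. pcompose f [:0, \<phi> ?b:]) p * p', map_mat (\<lambda>f. pcompose f [:0, \<phi> ?b:]) q * q')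
          \<in> EO_pairs n (scaled s (2 * (m + e)) T)" unfolding b(1) by (rule d1)
      from EO_pairs_conj_scaled[OF n ok e this]
      show "(map_mat (\<lambda>f. pcompose f [:0, \<phi> ?b:]) (oe n i j x * p) * (p' * oe n i j (- ?x)),
             map_mat (\<lambda>f. pcompose f [:0, \<phi> ?b:]) (oe n i j y * q) * (q' * oe n i j (- ?y)))
          \<in> EO_pairs n (scaled s m T)"
        unfolding split[OF c(1) c'(1)] split[OF c(2) c'(2)]
        by (rule EO_pairs.mul[OF ok, rotated]) (unfold b(2), rule d2)
    qed
  qed
  moreover have "mutual_inv n (map_mat (\<lambda>f. pcompose f 0) (oe n i j x * p)) (p' * oe n i j (- ?x))"
      "mutual_inv n (map_mat (\<lambda>f. pcompose f 0) (oe n i j y * q)) (q' * oe n i j (- ?y))"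
    unfolding map_mat_mult_square[OF hom oe_carrier c(1)] map_mat_mult_square[OF hom oe_carrier c(2)]
      map_mat_oe[OF hom]
    using inv by (intro mutual_inv_mult mutual_inv_oe ok; simp)+
  ultimately show ?case by blast
qed

end

section \<open>Normalising the lifted pair at X = 0\<close>

theorem mainTheorem8:
  fixes a :: "'a::comm_ring_1" and I :: "'a set" and n :: nat
    and \<phi> :: "'a \<Rightarrow> 'b::comm_ring_1" and \<alpha> :: "'b poly mat"
  assumes "is_ideal I" and "n \<ge> 3"
    and "\<forall>m. a ^ m \<noteq> 0"
    and "is_localisation a \<phi>"
    and "\<alpha> \<in> EO_rel n (ideal_gen ((\<lambda>r. [:\<phi> r:]) ` I))"
    and "map_mat (\<lambda>p. poly p 0) \<alpha> = 1\<^sub>m (2 * n)"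
  shows "\<exists>d::nat. \<forall>b. (\<exists>r. b = a ^ d * r) \<longrightarrow>
           (\<exists>\<alpha>' :: 'a poly mat. \<alpha>' \<in> EO_rel n (ideal_gen ((\<lambda>r. [:r:]) ` I)) \<and>
              map_mat (\<lambda>p. poly p 0) \<alpha>' = 1\<^sub>m (2 * n) \<and>
              map_mat (map_poly \<phi>) \<alpha>' = map_mat (\<lambda>p. pcompose p [:0, \<phi> b:]) \<alpha>)"
proof -
  interpret poly_localisation a \<phi> I by unfold_locales fact+
  note hom = comm_ring_hom_pcompose[where 'r = 'b] and hom' = comm_ring_hom_pcompose[where 'r = 'a]
  note J_ideal = is_ideal_ideal_gen[of "(\<lambda>r. [:r:]) ` I"]
  let ?ev = "\<lambda>p :: 'b poly. pcompose p 0" and ?ev' = "\<lambda>p :: 'a poly. pcompose p 0"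
  have pairs: "(1\<^sub>m (2 * n), \<alpha>) \<in> EO_pairs n (cong_pairs J')"
    using assms(5) by (intro EO_rel_pairs is_ideal_ideal_gen)
  note \<alpha>_carrier = EO_pairs_carrier(2)[OF pairs]
  \<comment> \<open>Evaluation at 0 is rephrased as substitution of 0, which stays in the polynomial
    ring.\<close>
  have "map_mat ?ev \<alpha> = map_mat (\<lambda>c. [:c:]) (map_mat (\<lambda>p. poly p 0) \<alpha>)"
    by (rule eq_matI) (simp_all add: pcompose_0' poly_0_coeff_0)
  also have "\<dots> = 1\<^sub>m (2 * n)"
    unfolding assms(6) by (rule eq_matI) (auto simp: one_pCons)
  finally have \<alpha>0: "map_mat ?ev \<alpha> = 1\<^sub>m (2 * n)" .
  obtain p' q' where inv: "mutual_inv n (1\<^sub>m (2 * n)) p'" "mutual_inv n (1\<^sub>m (2 * n)) q'"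
    and dil: "\<And>m. \<exists>d. \<forall>r. (map_mat (\<lambda>f. pcompose f [:0, \<phi> (a ^ d * r):]) (1\<^sub>m (2 * n)) * p',
                   map_mat (\<lambda>f. pcompose f [:0, \<phi> (a ^ d * r):]) \<alpha> * q') \<in> EO_pairs n (scaled s m T)"
    using EO_pairs_dilate[OF assms(2) pairs] unfolding \<alpha>0 map_mat_one_square[OF hom] by blast
  \<comment> \<open>Both components are the identity at 0, so the normalising factors are
    trivial.\<close>
  have p'q': "p' = 1\<^sub>m (2 * n)" "q' = 1\<^sub>m (2 * n)"
    using inv mutual_inv_unique mutual_inv_one by metis+
  obtain d where d: "\<And>r. (1\<^sub>m (2 * n), map_mat (\<lambda>f. pcompose f [:0, \<phi> (a ^ d * r):]) \<alpha>) \<in> EO_pairs n T"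
  proof -
    \<comment> \<open>\<open>m = 0\<close> is enough: parameters in \<open>T\<close> already lift to
      R[X].\<close>
    have "scaled s 0 T = T" by (auto simp: scaled_def)
    then show ?thesis
      using that dil[of 0] \<alpha>_carrier unfolding p'q' map_mat_one_square[OF hom] by auto
  qed
  have "\<exists>\<alpha>' :: 'a poly mat. \<alpha>' \<in> EO_rel n J \<and> map_mat (\<lambda>p. poly p 0) \<alpha>' = 1\<^sub>m (2 * n) \<and>
          map_mat \<Phi> \<alpha>' = map_mat (\<lambda>p. pcompose p [:0, \<phi> (a ^ d * r):]) \<alpha>" for r
  proof -
    let ?\<alpha>b = "map_mat (\<lambda>f. pcompose f [:0, \<phi> (a ^ d * r):]) \<alpha>"
    \<comment> \<open>\<open>\<beta>\<close> becomes the identity only after localisation, hence the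
      corrections below.\<close>
    obtain \<beta> \<gamma> where lift: "(\<beta>, \<gamma>) \<in> EO_pairs n (cong_pairs J)" and \<beta>: "map_mat \<Phi> \<beta> = 1\<^sub>m (2 * n)"
      and \<gamma>: "map_mat \<Phi> \<gamma> = ?\<alpha>b"
      using EO_pairs_lift[OF Phi_hom d[of r]] by blast
    have "map_prod ?ev' ?ev' ` cong_pairs J \<subseteq> cong_pairs J"
      using cong_pairs_pcompose by auto
    from EO_pairs_mono[OF this EO_pairs_map[OF hom' lift]]
    have lift0: "(map_mat ?ev' \<beta>, map_mat ?ev' \<gamma>) \<in> EO_pairs n (cong_pairs J)" .
    \<comment> \<open>These invert \<beta>(0) and \<gamma>(0), so that
      \<open>\<beta> * \<beta>0\<close> and \<open>\<gamma> * \<gamma>0\<close> are the identity at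
      0 and still form a pair over the double ring.\<close>
    obtain \<beta>0 \<gamma>0 where inv0: "(\<beta>0, \<gamma>0) \<in> EO_pairs n (cong_pairs J)"
      "mutual_inv n (map_mat ?ev' \<beta>) \<beta>0" "mutual_inv n (map_mat ?ev' \<gamma>) \<gamma>0"
      using EO_pairs_ex_inverse[OF cong_pairs_neg[OF J_ideal] lift0] by blast
    note c = EO_pairs_carrier[OF lift] EO_pairs_carrier[OF inv0(1)]
    have norm: "(\<beta> * \<beta>0, \<gamma> * \<gamma>0) \<in> EO_pairs n (cong_pairs J)"
      by (rule EO_pairs_mult[OF lift inv0(1)])
    obtain \<rho> where \<rho>: "mutual_inv n (\<beta> * \<beta>0) \<rho>" "\<rho> * (\<gamma> * \<gamma>0) \<in> EO_rel n J"
      using EO_pairs_EO_rel[OF J_ideal norm] by blast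
    have c\<rho>: "\<rho> \<in> carrier_mat (2 * n) (2 * n)" "\<gamma> * \<gamma>0 \<in> carrier_mat (2 * n) (2 * n)"
      using \<rho>(1) EO_pairs_carrier[OF norm] by (auto simp: mutual_inv_def)
    have ev_idem: "map_mat ?ev' (map_mat ?ev' M) = map_mat ?ev' M" for M
      by (rule eq_matI) (simp_all add: pcompose_0')
    have at0: "map_mat ?ev' (M * M0) = 1\<^sub>m (2 * n)"
      if "mutual_inv n (map_mat ?ev' M) M0" "M \<in> carrier_mat (2 * n) (2 * n)" for M M0
    proof -
      have "mutual_inv n (map_mat ?ev' M) (map_mat ?ev' M0)"
        using mutual_inv_map[OF hom' that(1), of 0] unfolding ev_idem .
      then show ?thesis
        using that map_mat_mult_square[OF hom' that(2), of M0 0] by (auto simp: mutual_inv_def)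
    qed
    have \<Phi>_ev: "map_mat \<Phi> (map_mat ?ev' M) = map_mat ?ev (map_mat \<Phi> M)" for M
      by (rule eq_matI) (simp_all add: phi.map_poly_pcompose)
    \<comment> \<open>\<alpha>(bX) and \<alpha>(X) agree at X = 0. Hence \<gamma>(0) localises to
      the identity, and the correction \<open>\<gamma>0\<close> disappears after
      localisation.\<close>
    have "map_mat ?ev ?\<alpha>b = map_mat ?ev \<alpha>"
      by (rule eq_matI) (simp_all add: pcompose_assoc[symmetric] pcompose_pCons)
    then have "map_mat \<Phi> (map_mat ?ev' \<gamma>) = 1\<^sub>m (2 * n)"
      unfolding \<Phi>_ev \<gamma> using \<alpha>0 by simp
    then have \<gamma>0: "map_mat \<Phi> \<gamma>0 = 1\<^sub>m (2 * n)"
      using mutual_inv_map[OF Phi_hom inv0(3)] mutual_inv_unique mutual_inv_one by metis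
    have "map_mat \<Phi> (map_mat ?ev' \<beta>) = 1\<^sub>m (2 * n)"
      unfolding \<Phi>_ev \<beta> by (rule map_mat_one_square[OF hom])
    then have \<beta>0: "map_mat \<Phi> \<beta>0 = 1\<^sub>m (2 * n)"
      using mutual_inv_map[OF Phi_hom inv0(2)] mutual_inv_unique mutual_inv_one by metis
    have "map_mat \<Phi> (\<beta> * \<beta>0) = 1\<^sub>m (2 * n)"
      unfolding map_mat_mult_square[OF Phi_hom c(1,3)] \<beta> \<beta>0 by simp
    then have \<rho>\<Phi>: "map_mat \<Phi> \<rho> = 1\<^sub>m (2 * n)"
      using mutual_inv_map[OF Phi_hom \<rho>(1)] mutual_inv_unique mutual_inv_one by metis
    have "map_mat ?ev' (\<beta> * \<beta>0) = 1\<^sub>m (2 * n)" by (rule at0[OF inv0(2) c(1)])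
    then have \<rho>0: "map_mat ?ev' \<rho> = 1\<^sub>m (2 * n)"
      using mutual_inv_map[OF hom' \<rho>(1), of 0] mutual_inv_unique mutual_inv_one by metis
    \<comment> \<open>After localisation only \<open>\<gamma>\<close> contributes; at X = 0 both
      factors are the identity.\<close>
    let ?\<alpha>' = "\<rho> * (\<gamma> * \<gamma>0)"
    have "map_mat \<Phi> ?\<alpha>' = ?\<alpha>b"
      using \<alpha>_carrier
      unfolding map_mat_mult_square[OF Phi_hom c\<rho>] map_mat_mult_square[OF Phi_hom c(2,4)] \<rho>\<Phi> \<gamma> \<gamma>0 by simp
    moreover have ev1: "map_mat ?ev' ?\<alpha>' = 1\<^sub>m (2 * n)"
      unfolding map_mat_mult_square[OF hom' c\<rho>] \<rho>0 at0[OF inv0(3) c(2)] by simp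
    moreover have "map_mat (\<lambda>p. poly p 0) ?\<alpha>' = 1\<^sub>m (2 * n)"
    proof -
      have "map_mat (\<lambda>p. poly p 0) ?\<alpha>' = map_mat (\<lambda>p. coeff p 0) (map_mat ?ev' ?\<alpha>')"
        by (rule eq_matI) (simp_all add: poly_0_coeff_0)
      also have "map_mat (\<lambda>p. coeff p 0) (map_mat ?ev' ?\<alpha>') = 1\<^sub>m (2 * n)"
        unfolding ev1 by (rule eq_matI) auto
      finally show ?thesis .
    qed
    ultimately show ?thesis using \<rho>(2) by blast
  qed
  then show ?thesis by blast
qed

end
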